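(* In the setting of the context, assume $\mathcal J[1]\supseteq Q$. Then $\mathrm n_-\big(I_{\{P,Q\}}|_{\mathcal H_{\{P,Q\}}\times\mathcal H_{\{P,Q\}}}\big)=\mathrm n_-\big(I|_{\mathcal H_P(1)\times\mathcal H_P(1)}\big)+\mathrm n_-\big(F|_{\mathcal J_Q\times\mathcal J_Q}\big).$
   Context: Fix a nondegenerate symmetric bilinear form $g$ on $\mathbb R^n$ of index $1$, a continuous map $R:[0,1]\to\mathcal L(\mathbb R^n)$ with each $R(t)$ $g$-symmetric, a $C^2$ map $Y:[0,1]\to\mathbb R^n$ with $g(Y,Y)<0$ and $Y''=R(t)[Y]$, a $g$-nondegenerate subspace $P\subset\mathbb R^n$ with a $g$-symmetric linear map $S^P:P\to P$, and a subspace $Q\subset\mathbb R^n$ with a $g$-symmetric linear map $S^Q:Q\to Q$; $\perp$ denotes $g$-orthogonality. A Jacobi field is a solution of $V''=R(t)[V]$ on $[0,1]$; it is a $P$-Jacobi field if $V(0)\in P$ and $V'(0)+S^P[V(0)]\in P^\perp$; for a Jacobi field $J$ the quantity $C_J=g(J',Y)-g(J,Y')$ is constant. $H^1_{\{P,Q\}}$ is the space of $V\in H^1([0,1];\mathbb R^n)$ with $V(0)\in P$, $V(1)\in Q$, and $I_{\{P,Q\}}(V,W)=\int_0^1[g(V',W')+g(R(t)[V],W)]dt+g(S^Q[V(1)],W(1))-g(S^P[V(0)],W(0))$ on it. $\mathcal H_{\{P,Q\}}=\{V\in H^1_{\{P,Q\}}: g(V',Y)-g(V,Y')=0\text{ a.e.}\}$.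 $H^1_P([0,1];\mathbb R^n)=\{V\in H^1: V(0)\in P, V(1)=0\}$, $I$ is the restriction of $I_{\{P,Q\}}$ to it, and $\mathcal H_P(1)=\{V\in H^1_P: g(V',Y)-g(V,Y')=0\text{ a.e.}\}$. $\mathcal J^*_Q$ is the space of $P$-Jacobi fields $J$ with $J(1)\in Q$, $\mathcal J_Q=\{J\in\mathcal J^*_Q: C_J=0\}$, $F$ is the restriction of $I_{\{P,Q\}}$ to $\mathcal J^*_Q\times\mathcal J^*_Q$ (equivalently $F(J_1,J_2)=g(S^Q[J_1(1)],J_2(1))+g(J_1'(1),J_2(1))$), and $\mathcal J[1]=\{J(1): J\text{ a }P\text{-Jacobi field with }C_J=0\}$. $\mathrm n_-$ denotes the index (maximal dimension of a negative definite subspace). *)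

theory Defs
  imports "HOL-Analysis.Analysis"
begin

definition n_minus :: "('v::real_vector \<Rightarrow> 'v \<Rightarrow> real) \<Rightarrow> 'v set \<Rightarrow> enat" where
  "n_minus B S = Sup {enat (dim W) | W. subspace W \<and> W \<subseteq> S \<and>
       (\<forall>v\<in>W. v \<noteq> 0 \<longrightarrow> B v v < 0)}"

text \<open>Index of a form B on a space S of functions, where functions are identified
  when they agree on the domain D (here D = [0,1]); linear combinations are pointwise.
  This is the unfolded meaning of: maximal k such that there are k elements of S,
  linearly independent on D, spanning a subspace on which B is negative definite.\<close>
definition n_minus_fun :: "'b set \<Rightarrow> (('b \<Rightarrow> 'a::real_vector) \<Rightarrow> ('b \<Rightarrow> 'a) \<Rightarrow> real)
    \<Rightarrow> ('b \<Rightarrow> 'a) set \<Rightarrow> enat" where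
  "n_minus_fun D B S = Sup {enat k | k. \<exists>v :: nat \<Rightarrow> 'b \<Rightarrow> 'a.
       (\<forall>i<k. v i \<in> S) \<and>
       (\<forall>c. (\<forall>t\<in>D. (\<Sum>i<k. c i *\<^sub>R v i t) = 0) \<longrightarrow> (\<forall>i<k. c i = 0)) \<and>
       (\<forall>c. (\<exists>i<k. c i \<noteq> 0) \<longrightarrow>
            B (\<lambda>t. \<Sum>i<k. c i *\<^sub>R v i t) (\<lambda>t. \<Sum>i<k. c i *\<^sub>R v i t) < 0)}"

definition H1_weak_deriv :: "(real \<Rightarrow> 'a::euclidean_space) \<Rightarrow> (real \<Rightarrow> 'a) \<Rightarrow> bool" where
  "H1_weak_deriv V V' \<longleftrightarrow> V' integrable_on {0..1} \<and>
     (\<lambda>t. (norm (V' t))\<^sup>2) integrable_on {0..1} \<and>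
     (\<forall>t\<in>{0..1}. (V' has_integral (V t - V 0)) {0..t})"

definition H1 :: "(real \<Rightarrow> 'a::euclidean_space) set" where
  "H1 = {V. \<exists>V'. H1_weak_deriv V V'}"

text \<open>A (the, up to a.e. equality) weak derivative of an H^1 function.\<close>
definition hderiv :: "(real \<Rightarrow> 'a::euclidean_space) \<Rightarrow> real \<Rightarrow> 'a" where
  "hderiv V = (SOME V'. H1_weak_deriv V V')"

definition jderiv :: "(real \<Rightarrow> 'a::real_normed_vector) \<Rightarrow> real \<Rightarrow> 'a" where
  "jderiv J t = vector_derivative J (at t within {0..1})"

definition jacobi :: "(real \<Rightarrow> 'a \<Rightarrow>\<^sub>L 'a::euclidean_space) \<Rightarrow> (real \<Rightarrow> 'a) \<Rightarrow> bool" where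
  "jacobi R V \<longleftrightarrow> (\<exists>V' V''. \<forall>t\<in>{0..1}.
      (V has_vector_derivative V' t) (at t within {0..1}) \<and>
      (V' has_vector_derivative V'' t) (at t within {0..1}) \<and>
      V'' t = blinfun_apply (R t) (V t))"

definition P_jacobi :: "('a::euclidean_space \<Rightarrow> 'a \<Rightarrow> real) \<Rightarrow> (real \<Rightarrow> 'a \<Rightarrow>\<^sub>L 'a)
    \<Rightarrow> 'a set \<Rightarrow> ('a \<Rightarrow> 'a) \<Rightarrow> (real \<Rightarrow> 'a) \<Rightarrow> bool" where
  "P_jacobi g R P SP V \<longleftrightarrow> jacobi R V \<and> V 0 \<in> P \<and>
      (\<forall>w\<in>P. g (jderiv V 0 + SP (V 0)) w = 0)"

text \<open>The (constant) quantity C_J = g(J',Y) - g(J,Y'), evaluated at t = 0.\<close>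
definition C_const :: "('a::euclidean_space \<Rightarrow> 'a \<Rightarrow> real) \<Rightarrow> (real \<Rightarrow> 'a) \<Rightarrow> (real \<Rightarrow> 'a)
    \<Rightarrow> (real \<Rightarrow> 'a) \<Rightarrow> real" where
  "C_const g Y Y' J = g (jderiv J 0) (Y 0) - g (J 0) (Y' 0)"

definition H1_PQ :: "'a set \<Rightarrow> 'a set \<Rightarrow> (real \<Rightarrow> 'a::euclidean_space) set" where
  "H1_PQ P Q = {V \<in> H1. V 0 \<in> P \<and> V 1 \<in> Q}"

definition I_PQ :: "('a::euclidean_space \<Rightarrow> 'a \<Rightarrow> real) \<Rightarrow> (real \<Rightarrow> 'a \<Rightarrow>\<^sub>L 'a)
    \<Rightarrow> ('a \<Rightarrow> 'a) \<Rightarrow> ('a \<Rightarrow> 'a) \<Rightarrow> (real \<Rightarrow> 'a) \<Rightarrow> (real \<Rightarrow> 'a) \<Rightarrow> real" where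
  "I_PQ g R SP SQ V W =
     integral {0..1} (\<lambda>t. g (hderiv V t) (hderiv W t) + g (blinfun_apply (R t) (V t)) (W t))
     + g (SQ (V 1)) (W 1) - g (SP (V 0)) (W 0)"

definition HH_PQ :: "('a::euclidean_space \<Rightarrow> 'a \<Rightarrow> real) \<Rightarrow> (real \<Rightarrow> 'a) \<Rightarrow> (real \<Rightarrow> 'a)
    \<Rightarrow> 'a set \<Rightarrow> 'a set \<Rightarrow> (real \<Rightarrow> 'a) set" where
  "HH_PQ g Y Y' P Q = {V \<in> H1_PQ P Q.
      negligible {t \<in> {0..1}. g (hderiv V t) (Y t) - g (V t) (Y' t) \<noteq> 0}}"

definition H1_P :: "'a set \<Rightarrow> (real \<Rightarrow> 'a::euclidean_space) set" where
  "H1_P P = {V \<in> H1. V 0 \<in> P \<and> V 1 = 0}"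

definition HH_P1 :: "('a::euclidean_space \<Rightarrow> 'a \<Rightarrow> real) \<Rightarrow> (real \<Rightarrow> 'a) \<Rightarrow> (real \<Rightarrow> 'a)
    \<Rightarrow> 'a set \<Rightarrow> (real \<Rightarrow> 'a) set" where
  "HH_P1 g Y Y' P = {V \<in> H1_P P.
      negligible {t \<in> {0..1}. g (hderiv V t) (Y t) - g (V t) (Y' t) \<noteq> 0}}"

definition JJ_star_Q :: "('a::euclidean_space \<Rightarrow> 'a \<Rightarrow> real) \<Rightarrow> (real \<Rightarrow> 'a \<Rightarrow>\<^sub>L 'a)
    \<Rightarrow> 'a set \<Rightarrow> ('a \<Rightarrow> 'a) \<Rightarrow> 'a set \<Rightarrow> (real \<Rightarrow> 'a) set" where
  "JJ_star_Q g R P SP Q = {J. P_jacobi g R P SP J \<and> J 1 \<in> Q}"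

definition JJ_Q :: "('a::euclidean_space \<Rightarrow> 'a \<Rightarrow> real) \<Rightarrow> (real \<Rightarrow> 'a \<Rightarrow>\<^sub>L 'a)
    \<Rightarrow> (real \<Rightarrow> 'a) \<Rightarrow> (real \<Rightarrow> 'a) \<Rightarrow> 'a set \<Rightarrow> ('a \<Rightarrow> 'a) \<Rightarrow> 'a set \<Rightarrow> (real \<Rightarrow> 'a) set" where
  "JJ_Q g R Y Y' P SP Q = {J \<in> JJ_star_Q g R P SP Q. C_const g Y Y' J = 0}"

definition JJ_1 :: "('a::euclidean_space \<Rightarrow> 'a \<Rightarrow> real) \<Rightarrow> (real \<Rightarrow> 'a \<Rightarrow>\<^sub>L 'a)
    \<Rightarrow> (real \<Rightarrow> 'a) \<Rightarrow> (real \<Rightarrow> 'a) \<Rightarrow> 'a set \<Rightarrow> ('a \<Rightarrow> 'a) \<Rightarrow> 'a set" where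
  "JJ_1 g R Y Y' P SP = {J 1 | J. P_jacobi g R P SP J \<and> C_const g Y Y' J = 0}"

end

(* A field V in H_{P,Q} ends in Q, so by hypothesis there is a P-Jacobi field J with C_J = 0 and
   J(1) = V(1); then V - J lies in H_P(1). Hence H_{P,Q} = H_P(1) + J_Q, and integration by parts
   shows that the two summands are orthogonal for the index form. The index is additive over such
   sums: given maximal negative definite subspaces of the summands, of dimensions p and q, a negative
   definite subspace of dimension k > p + q would contain a nonzero x = a + b orthogonal to both; by
   maximality the form is nonnegative at a and at b, hence at x. *)

theory Submission
  imports Defs
begin

section \<open>Additivity of the index\<close>

text \<open>The index counts functions up to agreement on [0,1], while \<open>hderiv\<close> picks
  one weak derivative out of many, with no linearity built into the choice. Two devices deal with
  this: indices are expressed by finite families together with coefficient vectors, so that no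
  quotient space appears, and the form and the constraint are restated for arbitrary weak
  derivatives, which is legitimate because any two agree almost everywhere. Maximal negative
  definite subspaces are available only when both indices on the right are finite; otherwise both
  sides are infinite, since the summands are contained in the sum. The integration by parts pairs
  the C^1 map J' with the field V - J, which is merely H^1, so a pointwise product rule cannot be
  invoked. Its boundary term at 1 vanishes because V - J does, and the one at 0 by the P-Jacobi
  condition.\<close>

definition comb :: "nat \<Rightarrow> (nat \<Rightarrow> real) \<Rightarrow> (nat \<Rightarrow> 'b \<Rightarrow> 'a::real_vector) \<Rightarrow> 'b \<Rightarrow> 'a" where
  "comb k c v = (\<lambda>t. \<Sum>i<k. c i *\<^sub>R v i t)"

lemma comb_0: "comb 0 c v = (\<lambda>t. 0)"
  by (simp add: comb_def)

lemma comb_Suc: "comb (Suc k) c v = (\<lambda>t. comb k c v t + c k *\<^sub>R v k t)"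
  by (simp add: comb_def)

lemma comb_cong:
  "(\<And>i. i < k \<Longrightarrow> c i = d i) \<Longrightarrow> (\<And>i. i < k \<Longrightarrow> v i = w i) \<Longrightarrow> comb k c v = comb k d w"
  by (simp add: comb_def)

lemma comb_zero_coeffs: "(\<And>i. i < k \<Longrightarrow> c i = 0) \<Longrightarrow> comb k c v = (\<lambda>t. 0)"
  by (simp add: comb_def)

lemma comb_append:
  "comb (p + q) c (\<lambda>i. if i < p then a i else b (i - p))
     = (\<lambda>t. comb p c a t + comb q (\<lambda>i. c (p + i)) b t)"
  by (induction q) (simp_all add: comb_0 comb_Suc comb_def fun_eq_iff)

text \<open>Negativity is demanded of coefficient vectors rather than of functions. This encodes
  linear independence as well: a nontrivial relation would yield the zero function, where a
  symmetric form takes the value 0. So \<open>k\<close> is the dimension of the span.\<close>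

definition neg_family ::
  "(('b \<Rightarrow> 'a::real_vector) \<Rightarrow> ('b \<Rightarrow> 'a) \<Rightarrow> real) \<Rightarrow> ('b \<Rightarrow> 'a) set \<Rightarrow> nat \<Rightarrow> (nat \<Rightarrow> 'b \<Rightarrow> 'a) \<Rightarrow> bool"
where
  "neg_family B S k v \<longleftrightarrow> (\<forall>i<k. v i \<in> S) \<and>
     (\<forall>c. (\<exists>i<k. c i \<noteq> 0) \<longrightarrow> B (comb k c v) (comb k c v) < 0)"

lemma neg_family_neg:
  "neg_family B S k v \<Longrightarrow> i < k \<Longrightarrow> c i \<noteq> 0 \<Longrightarrow> B (comb k c v) (comb k c v) < 0"
  by (auto simp: neg_family_def)

text \<open>Gaussian elimination by induction on the equations: each one either is trivial or
  removes one unknown, so an unknown remains at the end. It will produce the vector orthogonal to a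
  given finite family.\<close>

lemma homogeneous_system_nontrivial_solution:
  fixes M :: "'i \<Rightarrow> 'j \<Rightarrow> real"
  assumes "finite F" "finite I" "card F < card I"
  shows "\<exists>c. (\<exists>i\<in>I. c i \<noteq> 0) \<and> (\<forall>j\<in>F. (\<Sum>i\<in>I. c i * M i j) = 0)"
  using assms
proof (induction F arbitrary: I M rule: finite_induct)
  case empty
  then obtain i where "i \<in> I" by fastforce
  then show ?case by (intro exI[of _ "\<lambda>_. 1"]) auto
next
  case (insert j F)
  show ?case
  proof (cases "\<forall>i\<in>I. M i j = 0")
    case True
    have "card F < card I" using insert by simp
    then obtain c where "\<exists>i\<in>I. c i \<noteq> 0" "\<forall>l\<in>F. (\<Sum>i\<in>I. c i * M i l) = 0"
      using insert.IH[OF \<open>finite I\<close>, of M] by blast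
    then show ?thesis using True by (intro exI[of _ c]) auto
  next
    case False
    then obtain p where p: "p \<in> I" "M p j \<noteq> 0" by blast
    \<comment> \<open>Coefficients of the system after unknown \<open>p\<close> has been eliminated
      by means of equation \<open>j\<close>.\<close>
    define N where "N i l = M i l - M i j / M p j * M p l" for i l
    have "finite (I - {p})" "card F < card (I - {p})" using insert p by auto
    then obtain c where c: "\<exists>i\<in>I - {p}. c i \<noteq> 0" "\<forall>l\<in>F. (\<Sum>i\<in>I - {p}. c i * N i l) = 0"
      using insert.IH[of "I - {p}" N] by blast
    \<comment> \<open>Equation \<open>j\<close> forces the value \<open>- s\<close> on unknown
      \<open>p\<close> once the others are fixed.\<close>
    define s where "s = (\<Sum>i\<in>I - {p}. c i * (M i j / M p j))"
    have split: "(\<Sum>i\<in>I. (c(p := - s)) i * M i l) = (\<Sum>i\<in>I - {p}. c i * N i l)" for l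
    proof -
      have "(\<Sum>i\<in>I. (c(p := - s)) i * M i l) = - s * M p l + (\<Sum>i\<in>I - {p}. c i * M i l)"
        using insert.prems p by (simp add: sum.remove)
      also have "\<dots> = (\<Sum>i\<in>I - {p}. c i * N i l)"
        by (simp add: s_def N_def sum_distrib_right right_diff_distrib sum_subtractf mult.assoc)
      finally show ?thesis .
    qed
    have "(\<Sum>i\<in>I - {p}. c i * N i j) = 0" using p by (simp add: N_def)
    then show ?thesis using c split by (intro exI[of _ "c(p := - s)"]) auto
  qed
qed

text \<open>The laws are relative to \<open>S\<close>: a form given by an integral is additive where
  its integrands are integrable, not on arbitrary functions.\<close>

locale symmetric_form =
  fixes S :: "('b \<Rightarrow> 'a::real_vector) set"
    and B :: "('b \<Rightarrow> 'a) \<Rightarrow> ('b \<Rightarrow> 'a) \<Rightarrow> real"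
  assumes zero_mem: "(\<lambda>t. 0) \<in> S"
    and add_mem: "x \<in> S \<Longrightarrow> y \<in> S \<Longrightarrow> (\<lambda>t. x t + y t) \<in> S"
    and scale_mem: "x \<in> S \<Longrightarrow> (\<lambda>t. r *\<^sub>R x t) \<in> S"
    and add_left: "x \<in> S \<Longrightarrow> y \<in> S \<Longrightarrow> z \<in> S \<Longrightarrow> B (\<lambda>t. x t + y t) z = B x z + B y z"
    and scale_left: "x \<in> S \<Longrightarrow> z \<in> S \<Longrightarrow> B (\<lambda>t. r *\<^sub>R x t) z = r * B x z"
    and sym: "x \<in> S \<Longrightarrow> y \<in> S \<Longrightarrow> B x y = B y x"
begin

lemma add_right: "x \<in> S \<Longrightarrow> y \<in> S \<Longrightarrow> z \<in> S \<Longrightarrow> B z (\<lambda>t. x t + y t) = B z x + B z y"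
  using add_left[of x y z] add_mem[of x y] sym by simp

lemma scale_right: "x \<in> S \<Longrightarrow> z \<in> S \<Longrightarrow> B z (\<lambda>t. r *\<^sub>R x t) = r * B z x"
  using scale_left[of x z r] scale_mem[of x r] sym by simp

lemma zero_left: "z \<in> S \<Longrightarrow> B (\<lambda>t. 0) z = 0"
  using scale_left[of "\<lambda>t. 0" z 0] zero_mem by simp

lemma comb_mem: "(\<And>i. i < k \<Longrightarrow> v i \<in> S) \<Longrightarrow> comb k c v \<in> S"
  by (induction k) (simp_all add: comb_0 comb_Suc zero_mem add_mem scale_mem)

lemma comb_left:
  "(\<And>i. i < k \<Longrightarrow> v i \<in> S) \<Longrightarrow> z \<in> S \<Longrightarrow> B (comb k c v) z = (\<Sum>i<k. c i * B (v i) z)"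
  by (induction k)
    (simp_all add: comb_0 comb_Suc zero_left add_left scale_left comb_mem scale_mem)

lemma square_add_orthogonal:
  assumes "x \<in> S" "y \<in> S" "B x y = 0"
  shows "B (\<lambda>t. x t + y t) (\<lambda>t. x t + y t) = B x x + B y y"
  proof -
  have "B y x = 0" using assms sym[of y x] by simp
  then show ?thesis using assms by (simp add: add_left add_right add_mem)
qed

lemma square_comb_le_0: "neg_family B S k v \<Longrightarrow> B (comb k c v) (comb k c v) \<le> 0"
  by (cases "\<exists>i<k. c i \<noteq> 0")
    (auto simp: neg_family_def comb_zero_coeffs zero_left zero_mem intro: less_imp_le)

text \<open>A nontrivial combination vanishing on \<open>D\<close> would have square 0 by
  \<open>local\<close>, against negativity; hence every \<open>neg_family\<close> is independent on
  \<open>D\<close>.\<close>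

lemma n_minus_fun_eq_Sup:
  assumes local: "\<And>x. x \<in> S \<Longrightarrow> (\<forall>t\<in>D. x t = 0) \<Longrightarrow> B x x = 0"
  shows "n_minus_fun D B S = Sup (enat ` {k. \<exists>v. neg_family B S k v})"
proof -
  have "\<forall>i<k. c i = 0"
    if "neg_family B S k v" "\<forall>t\<in>D. comb k c v t = 0" for k v c
  proof (rule ccontr)
    assume "\<not> (\<forall>i<k. c i = 0)"
    then have "B (comb k c v) (comb k c v) < 0"
      using that(1) by (auto simp: neg_family_def)
    moreover have "comb k c v \<in> S" using that(1) by (auto simp: neg_family_def intro: comb_mem)
    ultimately show False using local that(2) by fastforce
  qed
  then have "{enat k | k. \<exists>v :: nat \<Rightarrow> 'b \<Rightarrow> 'a.
       (\<forall>i<k. v i \<in> S) \<and>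
       (\<forall>c. (\<forall>t\<in>D. comb k c v t = 0) \<longrightarrow> (\<forall>i<k. c i = 0)) \<and>
       (\<forall>c. (\<exists>i<k. c i \<noteq> 0) \<longrightarrow> B (comb k c v) (comb k c v) < 0)}
    = {enat k | k. \<exists>v. neg_family B S k v}"
    unfolding neg_family_def by blast
  also have "\<dots> = enat ` {k. \<exists>v. neg_family B S k v}" by blast
  finally show ?thesis by (simp add: n_minus_fun_def comb_def)
qed

text \<open>By orthogonality the square splits into the old square plus
  \<open>(c k)\<^sup>2 * B a a\<close>. The second term is negative unless \<open>c k = 0\<close>,
  and then the first one is. Read contrapositively: a vector orthogonal to a family that cannot be
  lengthened has nonnegative square.\<close>

lemma neg_family_extend:
  assumes v: "neg_family B S k v" and a: "a \<in> S" "B a a < 0"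
    and orth: "\<And>i. i < k \<Longrightarrow> B (v i) a = 0"
  shows "neg_family B S (Suc k) (v(k := a))"
  unfolding neg_family_def
proof (intro conjI allI impI)
  fix i assume "i < Suc k"
  then show "(v(k := a)) i \<in> S" using v a by (auto simp: neg_family_def)
next
  fix c :: "nat \<Rightarrow> real" assume c: "\<exists>i<Suc k. c i \<noteq> 0"
  have vS: "\<And>i. i < k \<Longrightarrow> v i \<in> S" using v by (auto simp: neg_family_def)
  have "comb k c (v(k := a)) = comb k c v" by (rule comb_cong) auto
  then have eq: "comb (Suc k) c (v(k := a)) = (\<lambda>t. comb k c v t + c k *\<^sub>R a t)"
    by (simp add: comb_Suc)
  have "B (comb k c v) (\<lambda>t. c k *\<^sub>R a t) = 0"
    using vS a orth by (simp add: scale_right comb_mem comb_left)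
  then have "B (comb (Suc k) c (v(k := a))) (comb (Suc k) c (v(k := a)))
      = B (comb k c v) (comb k c v) + (c k)\<^sup>2 * B a a"
    unfolding eq using vS a
    by (simp add: square_add_orthogonal comb_mem scale_mem scale_left scale_right power2_eq_square)
  also have "\<dots> < 0"
  proof (cases "c k = 0")
    case True
    then have "\<exists>i<k. c i \<noteq> 0" using c less_Suc_eq by auto
    then show ?thesis using v True by (auto simp: neg_family_def)
  next
    case False
    then have "(c k)\<^sup>2 * B a a < 0" using a by (simp add: mult_pos_neg)
    then show ?thesis using square_comb_le_0[OF v] by (meson add_nonpos_neg)
  qed
  finally show "B (comb (Suc k) c (v(k := a))) (comb (Suc k) c (v(k := a))) < 0" .
qed

lemma symmetric_form_subset:
  assumes "A \<subseteq> S" "(\<lambda>t. 0) \<in> A"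
    and "\<And>x y. x \<in> A \<Longrightarrow> y \<in> A \<Longrightarrow> (\<lambda>t. x t + y t) \<in> A"
    and "\<And>x r. x \<in> A \<Longrightarrow> (\<lambda>t. r *\<^sub>R x t) \<in> A"
  shows "symmetric_form A B"
  by unfold_locales (use assms in \<open>simp_all add: subset_iff add_left scale_left\<close>, metis sym)

text \<open>The sum need not be direct: elements of the intersection lie in the kernel of the form.\<close>

theorem n_minus_fun_orthogonal_sum:
  assumes A: "symmetric_form A B" "A \<subseteq> S" and C: "symmetric_form C B" "C \<subseteq> S"
    and sum: "\<And>x. x \<in> S \<Longrightarrow> \<exists>a\<in>A. \<exists>b\<in>C. x = (\<lambda>t. a t + b t)"
    and orth: "\<And>a b. a \<in> A \<Longrightarrow> b \<in> C \<Longrightarrow> B a b = 0"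
    and local: "\<And>x. x \<in> S \<Longrightarrow> (\<forall>t\<in>D. x t = 0) \<Longrightarrow> B x x = 0"
  shows "n_minus_fun D B S = n_minus_fun D B A + n_minus_fun D B C"
proof -
  interpret A: symmetric_form A B by fact
  interpret C: symmetric_form C B by fact
  define K where "K T = {k. \<exists>v. neg_family B T k v}" for T
  have eq: "n_minus_fun D B S = Sup (enat ` K S)" "n_minus_fun D B A = Sup (enat ` K A)"
    "n_minus_fun D B C = Sup (enat ` K C)"
    unfolding K_def using A(2) C(2) local
    by (auto intro!: n_minus_fun_eq_Sup A.n_minus_fun_eq_Sup C.n_minus_fun_eq_Sup)
  \<comment> \<open>The empty family; it makes \<open>Max\<close> meaningful in the finite
    case.\<close>
  have ne: "0 \<in> K T" for T by (simp add: K_def neg_family_def)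
  have sub: "K A \<subseteq> K S" "K C \<subseteq> K S"
    using A(2) C(2) by (auto simp: K_def neg_family_def subset_iff)
  have add: "p + q \<in> K S" if "p \<in> K A" "q \<in> K C" for p q
  proof -
    from that obtain a b where a: "neg_family B A p a" and b: "neg_family B C q b"
      by (auto simp: K_def)
    have aA: "\<And>i. i < p \<Longrightarrow> a i \<in> A" and bC: "\<And>i. i < q \<Longrightarrow> b i \<in> C"
      using a b by (auto simp: neg_family_def)
    define v where "v i = (if i < p then a i else b (i - p))" for i
    have "neg_family B S (p + q) v"
      unfolding neg_family_def
    proof (intro conjI allI impI)
      fix i assume "i < p + q"
      then show "v i \<in> S" using aA[of i] bC[of "i - p"] A(2) C(2) by (auto simp: v_def)
    next
      fix c :: "nat \<Rightarrow> real" assume c: "\<exists>i<p + q. c i \<noteq> 0"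
      define x where "x = comb p c a"
      define y where "y = comb q (\<lambda>i. c (p + i)) b"
      have xy: "x \<in> A" "y \<in> C" using aA bC by (simp_all add: x_def y_def A.comb_mem C.comb_mem)
      have le: "B x x \<le> 0" "B y y \<le> 0"
        unfolding x_def y_def by (rule A.square_comb_le_0[OF a], rule C.square_comb_le_0[OF b])
      obtain i where i: "i < p + q" "c i \<noteq> 0" using c by blast
      \<comment> \<open>A nonzero coefficient sits in one of the two blocks. That block has negative
        square, while the other may be zero and contributes only \<open>\<le> 0\<close>.\<close>
      have "B x x < 0 \<or> B y y < 0"
      proof (cases "i < p")
        case True
        then show ?thesis using neg_family_neg[OF a True, of c] i(2) by (simp add: x_def)
      next
        case False
        then show ?thesis
          using neg_family_neg[OF b, of "i - p" "\<lambda>i. c (p + i)"] i by (simp add: y_def)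
      qed
      then have "B x x + B y y < 0" using le by linarith
      moreover have "comb (p + q) c v = (\<lambda>t. x t + y t)"
        by (simp add: v_def[abs_def] comb_append x_def y_def)
      ultimately show "B (comb (p + q) c v) (comb (p + q) c v) < 0"
        using xy A(2) C(2) orth by (simp add: square_add_orthogonal subset_iff)
    qed
    then show ?thesis by (auto simp: K_def)
  qed
  \<comment> \<open>Maximality of \<open>p\<close> and \<open>q\<close> enters only as the
    impossibility of a family that is longer by one.\<close>
  have bound: "k \<le> p + q"
    if k: "k \<in> K S" and p: "p \<in> K A" "Suc p \<notin> K A" and q: "q \<in> K C" "Suc q \<notin> K C" for k p q
  proof (rule ccontr)
    assume "\<not> k \<le> p + q"
    from k p q obtain v a b where v: "neg_family B S k v" and a: "neg_family B A p a"
      and b: "neg_family B C q b" by (auto simp: K_def)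
    have vS: "\<And>i. i < k \<Longrightarrow> v i \<in> S" and aA: "\<And>i. i < p \<Longrightarrow> a i \<in> A"
      and bC: "\<And>i. i < q \<Longrightarrow> b i \<in> C"
      using v a b by (auto simp: neg_family_def)
    define w where "w j = (if j < p then a j else b (j - p))" for j
    have wS: "w j \<in> S" if "j < p + q" for j
      using that aA[of j] bC[of "j - p"] A(2) C(2) by (auto simp: w_def)
    \<comment> \<open>Orthogonality to the \<open>p + q\<close> vectors \<open>w j\<close> is a
      homogeneous system for the \<open>k\<close> coefficients of a vector in the span of
      \<open>v\<close>, with fewer equations than unknowns.\<close>
    have "card {..<p + q} < card {..<k}" using \<open>\<not> k \<le> p + q\<close> by simp
    then obtain c where c: "\<exists>i\<in>{..<k}. c i \<noteq> 0"
      "\<forall>j\<in>{..<p + q}. (\<Sum>i<k. c i * B (v i) (w j)) = 0"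
      using homogeneous_system_nontrivial_solution[of "{..<p + q}" "{..<k}" "\<lambda>i j. B (v i) (w j)"]
      by auto
    define x where "x = comb k c v"
    have xS: "x \<in> S" using vS by (simp add: x_def comb_mem)
    have xw: "B x (w j) = 0" if "j < p + q" for j
      unfolding x_def using c that vS wS by (simp add: comb_left)
    obtain y z where yz: "y \<in> A" "z \<in> C" "x = (\<lambda>t. y t + z t)" using sum xS by blast
    have yzS: "y \<in> S" "z \<in> S" using yz A(2) C(2) by auto
    \<comment> \<open>Orthogonality to \<open>a j\<close> passes from \<open>x\<close> to its
      summand \<open>y\<close>, because the other summand \<open>z\<close> is orthogonal to all of
      \<open>A\<close>.\<close>
    have "B (a j) y = 0" if "j < p" for j
    proof -
      have "B x (a j) = B y (a j) + B z (a j)"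
        using yz(3) yzS aA[OF that] A(2) by (auto intro: add_left)
      also have "B z (a j) = 0"
        using orth[OF aA[OF that] yz(2)] sym[of z "a j"] yzS aA[OF that] A(2) by auto
      finally show ?thesis using xw[of j] that sym[of y "a j"] yzS aA[OF that] A(2)
        by (auto simp: w_def)
    qed
    \<comment> \<open>Otherwise \<open>y\<close> would extend the family \<open>a\<close> to length
      \<open>Suc p\<close> inside \<open>A\<close>.\<close>
    then have y: "B y y \<ge> 0"
      using A.neg_family_extend[OF a yz(1)] p(2) by (force simp: K_def)
    have "B (b j) z = 0" if "j < q" for j
    proof -
      have "B x (b j) = B y (b j) + B z (b j)"
        using yz(3) yzS bC[OF that] C(2) by (auto intro: add_left)
      then show ?thesis
        using orth[OF yz(1) bC[OF that]] xw[of "p + j"] that sym[of z "b j"] yzS bC[OF that] C(2)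
        by (auto simp: w_def)
    qed
    then have z: "B z z \<ge> 0"
      using C.neg_family_extend[OF b yz(2)] q(2) by (force simp: K_def)
    have "B x x = B y y + B z z"
      unfolding yz(3) using yz yzS orth by (simp add: square_add_orthogonal)
    moreover have "B x x < 0"
      using c(1) v unfolding x_def by (auto intro: neg_family_neg)
    ultimately show False using y z by linarith
  qed
  have Sup_inf: "Sup (enat ` X) = \<infinity>" if "infinite X" for X
    using that finite_imageD[of enat X] by (auto simp: Sup_enat_def inj_on_def)
  have Max: "m \<in> X \<and> Suc m \<notin> X \<and> Sup (enat ` X) = enat m"
    if "finite X" "0 \<in> X" "m = Max X" for X m
  proof -
    have "m \<in> X" using that by (auto intro!: Max_in)
    moreover have "\<forall>k\<in>X. k \<le> m" using that by auto
    ultimately show ?thesis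
      by (auto simp: image_iff intro!: antisym Sup_least Sup_upper)
  qed
  show ?thesis
  proof (cases "finite (K A) \<and> finite (K C)")
    \<comment> \<open>An infinite set of lengths has supremum \<infinity>, and \<open>K S\<close>
      contains both \<open>K A\<close> and \<open>K C\<close>.\<close>
    case False
    then have "infinite (K S)" using sub finite_subset by blast
    then show ?thesis using False by (auto simp: eq Sup_inf)
  next
    case True
    define p where "p = Max (K A)"
    define q where "q = Max (K C)"
    have p: "p \<in> K A" "Suc p \<notin> K A" "Sup (enat ` K A) = enat p"
      using Max[OF _ ne p_def] True by auto
    have q: "q \<in> K C" "Suc q \<notin> K C" "Sup (enat ` K C) = enat q"
      using Max[OF _ ne q_def] True by auto
    have "Sup (enat ` K S) = enat (p + q)"
      using bound[OF _ p(1,2) q(1,2)] add[OF p(1) q(1)]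
      by (intro antisym Sup_least Sup_upper) auto
    then show ?thesis by (simp add: eq p q)
  qed
qed

end

section \<open>Weak derivatives\<close>

text \<open>Nonnegativity upgrades gauge integrability to Lebesgue integrability, where a vanishing
  integral forces vanishing almost everywhere.\<close>

lemma has_integral_0_nonneg_imp_negligible:
  fixes f :: "'m::euclidean_space \<Rightarrow> real"
  assumes int: "(f has_integral 0) S" and nonneg: "\<And>x. x \<in> S \<Longrightarrow> 0 \<le> f x"
  shows "negligible {x \<in> S. f x \<noteq> 0}"
proof -
  have f: "f absolutely_integrable_on S"
    using int nonneg by (auto intro: nonnegative_absolutely_integrable_1)
  then have "integral\<^sup>L lebesgue (\<lambda>x. indicat_real S x *\<^sub>R f x) = 0"
    using set_lebesgue_integral_eq_integral(2)[OF f] int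
    by (simp add: set_lebesgue_integral_def integral_unique)
  then have "AE x in lebesgue. indicat_real S x *\<^sub>R f x = 0"
    using f nonneg
    by (subst (asm) integral_nonneg_eq_0_iff_AE) (auto simp: set_integrable_def indicator_def)
  then obtain N where "negligible N" "{x. \<not> indicat_real S x *\<^sub>R f x = 0} \<subseteq> N"
    by (auto simp: eventually_ae_filter_negligible)
  then show ?thesis by (auto elim!: negligible_subset simp: indicator_def)
qed

text \<open>Henstock's lemma bounds the Riemann sums of \<open>norm \<circ> f\<close> directly, so neither absolute
  integrability nor a differentiation theorem is needed.\<close>

lemma interval_integrals_0_imp_negligible:
  fixes f :: "'m::euclidean_space \<Rightarrow> 'n::euclidean_space"
  assumes int: "f integrable_on cbox a b"
    and zero: "\<And>c d. cbox c d \<subseteq> cbox a b \<Longrightarrow> integral (cbox c d) f = 0"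
  shows "negligible {x \<in> cbox a b. f x \<noteq> 0}"
proof -
  have "((\<lambda>x. norm (f x)) has_integral 0) (cbox a b)"
    unfolding has_integral
  proof (intro allI impI)
    fix e :: real assume "0 < e"
    obtain \<gamma> where \<gamma>: "gauge \<gamma>" "\<And>p. \<lbrakk>p tagged_partial_division_of (cbox a b); \<gamma> fine p\<rbrakk> \<Longrightarrow>
             (\<Sum>(x,K)\<in>p. norm (measure lborel K *\<^sub>R f x - integral K f)) < e"
      using Henstock_lemma[OF int \<open>0 < e\<close>] by blast
    have "norm ((\<Sum>(x,K)\<in>p. measure lborel K *\<^sub>R norm (f x)) - 0) < e"
      if p: "p tagged_division_of cbox a b" "\<gamma> fine p" for p
    proof -
      \<comment> \<open>With these integrals gone, each error term in Henstock's sum is the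
        corresponding Riemann term of \<open>norm (f x)\<close>.\<close>
      have "integral K f = 0" if "(x, K) \<in> p" for x K
        using tagged_division_ofD(3,4)[OF p(1) that] zero by auto
      then have "(\<Sum>(x,K)\<in>p. measure lborel K *\<^sub>R norm (f x))
          = (\<Sum>(x,K)\<in>p. norm (measure lborel K *\<^sub>R f x - integral K f))"
        by (intro sum.cong) auto
      moreover have "\<dots> < e" using \<gamma>(2) p by (auto simp: tagged_division_of_def)
      moreover have "0 \<le> (\<Sum>(x,K)\<in>p. measure lborel K *\<^sub>R norm (f x))"
        by (intro sum_nonneg) auto
      ultimately show ?thesis by simp
    qed
    then show "\<exists>\<gamma>. gauge \<gamma> \<and> (\<forall>p. p tagged_division_of cbox a b \<and> \<gamma> fine p \<longrightarrow>
        norm ((\<Sum>(x,K)\<in>p. measure lborel K *\<^sub>R norm (f x)) - 0) < e)"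
      using \<gamma>(1) by blast
  qed
  from has_integral_0_nonneg_imp_negligible[OF this] show ?thesis by simp
qed

section \<open>Square-integrable maps on [0,1] and products of them\<close>

definition square_integrable :: "(real \<Rightarrow> 'a::euclidean_space) \<Rightarrow> bool" where
  "square_integrable f \<longleftrightarrow> f integrable_on {0..1} \<and> (\<lambda>t. (norm (f t))\<^sup>2) integrable_on {0..1}"

lemma square_integrable_measurable:
  "square_integrable f \<Longrightarrow> f \<in> borel_measurable (lebesgue_on {0..1})"
  by (auto simp: square_integrable_def intro: integrable_imp_measurable)

lemma square_integrable_continuous:
  "continuous_on {0..1} f \<Longrightarrow> square_integrable f"
  unfolding square_integrable_def
  by (intro conjI integrable_continuous_interval continuous_intros)

lemma square_integrable_scale:
  assumes "square_integrable f"
  shows "square_integrable (\<lambda>t. r *\<^sub>R f t)"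
  using assms integrable_on_mult_right[of "\<lambda>t. (norm (f t))\<^sup>2" "{0..1}" "r\<^sup>2"]
  by (auto simp: square_integrable_def power_mult_distrib intro: integrable_cmul)

lemma square_integrable_add:
  assumes f: "square_integrable f" and g: "square_integrable g"
  shows "square_integrable (\<lambda>t. f t + g t)"
proof -
  note [measurable] = f[THEN square_integrable_measurable] g[THEN square_integrable_measurable]
  have "(\<lambda>t. (norm (f t + g t))\<^sup>2) integrable_on {0..1}"
  proof (rule measurable_bounded_by_integrable_imp_integrable)
    show "(\<lambda>t. 2 * (norm (f t))\<^sup>2 + 2 * (norm (g t))\<^sup>2) integrable_on {0..1}"
      using f g by (auto simp: square_integrable_def intro!: integrable_add)
    have "(x + y)\<^sup>2 \<le> 2 * x\<^sup>2 + 2 * y\<^sup>2" for x y :: real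
      using zero_le_power2[of "x - y"] by (simp add: power2_eq_square algebra_simps)
    from order_trans[OF power_mono[OF norm_triangle_ineq] this]
    show "norm ((norm (f t + g t))\<^sup>2) \<le> 2 * (norm (f t))\<^sup>2 + 2 * (norm (g t))\<^sup>2" for t
      by simp
  qed (measurable, simp)
  then show ?thesis using f g by (auto simp: square_integrable_def intro: integrable_add)
qed

text \<open>Dominated by a multiple of the sum of the squared norms. This gives integrability of
  both terms of the index form and of the integrand in the integration by parts.\<close>

lemma square_integrable_bilinear:
  fixes h :: "'a::euclidean_space \<Rightarrow> 'b::euclidean_space \<Rightarrow> 'c::euclidean_space"
  assumes h: "bilinear h" and f: "square_integrable f" and g: "square_integrable g"
  shows "(\<lambda>t. h (f t) (g t)) integrable_on {0..1}"
proof -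
  obtain K where K: "0 < K" "\<And>x y. norm (h x y) \<le> norm x * norm y * K"
    using bounded_bilinear.pos_bounded[of h] h by (auto simp: bilinear_conv_bounded_bilinear)
  show ?thesis
  proof (rule measurable_bounded_by_integrable_imp_integrable)
    show "(\<lambda>t. h (f t) (g t)) \<in> borel_measurable (lebesgue_on {0..1})"
      using borel_measurable_bilinear[OF h f[THEN square_integrable_measurable]
          g[THEN square_integrable_measurable]] by simp
    show "(\<lambda>t. ((norm (f t))\<^sup>2 + (norm (g t))\<^sup>2) * K) integrable_on {0..1}"
      using f g by (auto simp: square_integrable_def intro!: integrable_add integrable_on_mult_left)
    have "x * y \<le> x\<^sup>2 + y\<^sup>2" for x y :: real
      using sum_squares_bound[of x y] zero_le_power2[of x] zero_le_power2[of y] by linarith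
    then show "norm (h (f t) (g t)) \<le> ((norm (f t))\<^sup>2 + (norm (g t))\<^sup>2) * K" for t
      using K(2)[of "f t" "g t"] K(1) by (meson mult_right_mono less_imp_le order_trans)
  qed simp
qed

section \<open>Weak derivatives: uniqueness, linearity, integration by parts\<close>

lemma H1_weak_deriv_iff:
  "H1_weak_deriv V V' \<longleftrightarrow>
     square_integrable V' \<and> (\<forall>t\<in>{0..1}. (V' has_integral (V t - V 0)) {0..t})"
  by (auto simp: H1_weak_deriv_def square_integrable_def)

lemma H1_weak_deriv_cong:
  assumes "\<And>t. t \<in> {0..1} \<Longrightarrow> V t = W t"
  shows "H1_weak_deriv V = H1_weak_deriv W"
  using assms by (auto simp: H1_weak_deriv_iff fun_eq_iff)

lemma hderiv: "V \<in> H1 \<Longrightarrow> H1_weak_deriv V (hderiv V)"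
  using someI_ex[of "H1_weak_deriv V"] by (simp add: H1_def hderiv_def)

lemma H1_weak_deriv_increment:
  assumes "H1_weak_deriv V V'" "0 \<le> a" "a \<le> b" "b \<le> 1"
  shows "(V' has_integral (V b - V a)) {a..b}"
proof -
  have "(V' has_integral (V a - V 0)) {0..a}" "(V' has_integral (V b - V 0)) {0..b}"
    using assms by (auto simp: H1_weak_deriv_iff)
  moreover from this(2) have "V' integrable_on {a..b}"
    using assms by (auto intro: integrable_on_subinterval)
  moreover have "integral {0..a} V' + integral {a..b} V' = integral {0..b} V'"
    using assms \<open>(V' has_integral (V b - V 0)) {0..b}\<close>
    by (intro Henstock_Kurzweil_Integration.integral_combine) auto
  ultimately have "integral {a..b} V' = V b - V a"
    by (metis (no_types, lifting) add_diff_cancel_left' diff_diff_eq2 diff_add_cancel integral_unique)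
  then show ?thesis using \<open>V' integrable_on {a..b}\<close> by (simp add: has_integral_iff)
qed

lemma H1_weak_deriv_continuous:
  assumes "H1_weak_deriv V V'"
  shows "continuous_on {0..1} V"
proof -
  have "continuous_on {0..1} (\<lambda>t. V 0 + integral {0..t} V')"
    using assms
    by (intro continuous_intros indefinite_integral_continuous_1) (auto simp: H1_weak_deriv_def)
  moreover have "V 0 + integral {0..t} V' = V t" if "t \<in> {0..1}" for t
    using assms that by (simp add: H1_weak_deriv_def integral_unique[of V' "V t - V 0"])
  ultimately show ?thesis by (rule continuous_on_eq)
qed

text \<open>Both candidates integrate to the same increment of \<open>V\<close> over each
  subinterval, so all interval integrals of their difference vanish. This makes the choice in
  \<open>hderiv\<close> harmless.\<close>

lemma H1_weak_deriv_unique: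
  assumes "H1_weak_deriv V A" "H1_weak_deriv V B"
  shows "negligible {t \<in> {0..1}. A t \<noteq> B t}"
proof -
  have "negligible {t \<in> cbox 0 1. A t - B t \<noteq> 0}"
  proof (rule interval_integrals_0_imp_negligible)
    show "(\<lambda>t. A t - B t) integrable_on cbox 0 1"
      using assms by (auto simp: H1_weak_deriv_def intro: integrable_diff)
    show "integral (cbox c d) (\<lambda>t. A t - B t) = 0" if "cbox c d \<subseteq> cbox 0 1" for c d
    proof (cases "c \<le> d")
      case True
      then have "0 \<le> c" "d \<le> 1" using that by auto
      then have "((\<lambda>t. A t - B t) has_integral ((V d - V c) - (V d - V c))) {c..d}"
        using assms True by (intro has_integral_diff H1_weak_deriv_increment) auto
      then show ?thesis by (auto intro: integral_unique)
    qed auto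
  qed
  then show ?thesis by simp
qed

lemma H1_weak_deriv_add:
  assumes "H1_weak_deriv V V'" "H1_weak_deriv W W'"
  shows "H1_weak_deriv (\<lambda>t. V t + W t) (\<lambda>t. V' t + W' t)"
proof -
  have "((\<lambda>t. V' t + W' t) has_integral (V t - V 0 + (W t - W 0))) {0..t}" if "t \<in> {0..1}" for t
    using assms that by (intro has_integral_add) (auto simp: H1_weak_deriv_iff)
  then show ?thesis
    using assms by (auto simp: H1_weak_deriv_iff square_integrable_add algebra_simps)
qed

lemma H1_weak_deriv_scale:
  assumes "H1_weak_deriv V V'"
  shows "H1_weak_deriv (\<lambda>t. r *\<^sub>R V t) (\<lambda>t. r *\<^sub>R V' t)"
proof -
  have "((\<lambda>t. r *\<^sub>R V' t) has_integral (r *\<^sub>R (V t - V 0))) {0..t}" if "t \<in> {0..1}" for t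
    using assms that by (intro has_integral_cmul) (auto simp: H1_weak_deriv_iff)
  then show ?thesis
    using assms by (auto simp: H1_weak_deriv_iff square_integrable_scale algebra_simps)
qed

lemma H1_weak_deriv_C1:
  assumes "\<And>t. t \<in> {0..1} \<Longrightarrow> (U has_vector_derivative U' t) (at t within {0..1})"
    and "continuous_on {0..1} U'"
  shows "H1_weak_deriv U U'"
  unfolding H1_weak_deriv_iff
proof (intro conjI ballI)
  fix t :: real assume "t \<in> {0..1}"
  then show "(U' has_integral (U t - U 0)) {0..t}"
    by (intro fundamental_theorem_of_calculus)
      (auto intro: has_vector_derivative_within_subset[OF assms(1)])
qed (use assms(2) in \<open>rule square_integrable_continuous\<close>)

text \<open>The weakly differentiable factor need not be differentiable anywhere, so the product rule
  is not available. Instead, the defect \<open>\<Phi>\<close> between the two sides satisfies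
  \<open>norm (\<Phi> b - \<Phi> a) \<le> C * (b - a) * (G b - G a)\<close> with a continuous function \<open>G\<close>;
  hence its derivative vanishes.\<close>

lemma integration_by_parts_weak:
  fixes h :: "'a::euclidean_space \<Rightarrow> 'b::euclidean_space \<Rightarrow> 'c::euclidean_space"
  assumes h: "bilinear h"
    and U: "\<And>t. t \<in> {0..1} \<Longrightarrow> (U has_vector_derivative U' t) (at t within {0..1})"
    and U': "continuous_on {0..1} U'"
    and W: "H1_weak_deriv W W'"
  shows "((\<lambda>t. h (U t) (W' t) + h (U' t) (W t)) has_integral (h (U 1) (W 1) - h (U 0) (W 0))) {0..1}"
proof -
  define f where "f t = h (U t) (W' t) + h (U' t) (W t)" for t
  \<comment> \<open>\<open>G\<close> controls the increments of \<open>W\<close>, and it is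
    continuous as an indefinite integral.\<close>
  define G where "G t = integral {0..t} (\<lambda>s. norm (W' s))" for t
  define \<Phi> where "\<Phi> t = integral {0..t} f - h (U t) (W t)" for t
  have UW: "H1_weak_deriv U U'" using U U' by (rule H1_weak_deriv_C1)
  have bb: "bounded_bilinear h" using h by (simp add: bilinear_conv_bounded_bilinear)
  note cont = H1_weak_deriv_continuous[OF UW] H1_weak_deriv_continuous[OF W]
  have sqW: "square_integrable W'" using W by (simp add: H1_weak_deriv_iff)
  have fint: "f integrable_on {0..1}"
    unfolding f_def using cont U' sqW
    by (intro integrable_add square_integrable_bilinear[OF h]) (auto intro: square_integrable_continuous)
  have W'abs: "(\<lambda>s. norm (W' s)) integrable_on {0..1}"
  proof (rule measurable_bounded_by_integrable_imp_integrable)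
    show "(\<lambda>s. 1 + (norm (W' s))\<^sup>2) integrable_on {0..1}"
      using sqW by (auto simp: square_integrable_def intro: integrable_add)
    show "norm (norm (W' s)) \<le> 1 + (norm (W' s))\<^sup>2" for s
      using sum_squares_bound[of 1 "norm (W' s)"] norm_ge_zero[of "W' s"]
      unfolding real_norm_def abs_norm_cancel one_power2 by linarith
  qed (use square_integrable_measurable[OF sqW] in \<open>measurable, simp\<close>)
  have G_diff: "G b - G a = integral {a..b} (\<lambda>s. norm (W' s))" if "0 \<le> a" "a \<le> b" "b \<le> 1" for a b
  proof -
    have "(\<lambda>s. norm (W' s)) integrable_on {0..b}"
      using W'abs that by (auto intro: integrable_on_subinterval)
    then show ?thesis
      using Henstock_Kurzweil_Integration.integral_combine[of 0 a b "\<lambda>s. norm (W' s)"] that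
      by (simp add: G_def algebra_simps)
  qed
  have W_diff: "norm (W b - W a) \<le> G b - G a" if "0 \<le> a" "a \<le> b" "b \<le> 1" for a b
  proof -
    have "(W' has_integral (W b - W a)) {a..b}" using W that by (rule H1_weak_deriv_increment)
    moreover have "(\<lambda>s. norm (W' s)) integrable_on {a..b}"
      using W'abs that by (auto intro: integrable_on_subinterval)
    ultimately show ?thesis
      unfolding G_diff[OF that]
      using Henstock_Kurzweil_Integration.integral_norm_bound_integral[of W' "{a..b}" "\<lambda>s. norm (W' s)"]
      by (auto simp: has_integral_iff)
  qed
  have G_mono: "G a \<le> G b" if "0 \<le> a" "a \<le> b" "b \<le> 1" for a b
    using W_diff[OF that] norm_ge_zero[of "W b - W a"] by linarith
  obtain K where K: "0 < K" "\<And>x y. norm (h x y) \<le> norm x * norm y * K"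
    using bounded_bilinear.pos_bounded[OF bb] by blast
  have "bounded (U' ` {0..1})"
    using U' by (intro compact_imp_bounded compact_continuous_image) auto
  then obtain M where M: "0 < M" "\<And>t. t \<in> {0..1} \<Longrightarrow> norm (U' t) \<le> M"
    unfolding bounded_pos by blast
  have U_diff: "norm (U b - U a) \<le> M * (b - a)" if "0 \<le> a" "a \<le> b" "b \<le> 1" for a b
  proof -
    have "norm (U b - U a) \<le> M * measure lborel {a..b}"
      using H1_weak_deriv_increment[OF UW that] M that
      by (intro has_integral_bound_real[of M "{}" U']) auto
    then show ?thesis using that by simp
  qed
  \<comment> \<open>The factor 2 counts the two error terms below, each contributing
    \<open>K * M * (b - a) * (G b - G a)\<close>.\<close>
  define C where "C = 2 * K * M"
  have key: "norm (\<Phi> b - \<Phi> a) \<le> C * (b - a) * (G b - G a)" if ab: "0 \<le> a" "a \<le> b" "b \<le> 1" for a b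
  proof -
    have f_ab: "(f has_integral (integral {0..b} f - integral {0..a} f)) {a..b}"
      using Henstock_Kurzweil_Integration.integral_combine[of 0 a b f] ab
        integrable_on_subinterval[OF fint, of a b] integrable_on_subinterval[OF fint, of 0 b]
      by (auto simp: has_integral_iff algebra_simps)
    have "((\<lambda>s. h (U b) (W' s)) has_integral h (U b) (W b - W a)) {a..b}"
      using has_integral_linear[OF H1_weak_deriv_increment[OF W ab]
          bounded_bilinear.bounded_linear_right[OF bb]] by (simp add: o_def)
    moreover have "((\<lambda>s. h (U' s) (W a)) has_integral h (U b - U a) (W a)) {a..b}"
      using has_integral_linear[OF H1_weak_deriv_increment[OF UW ab]
          bounded_bilinear.bounded_linear_left[OF bb]] by (simp add: o_def)
    ultimately have "((\<lambda>s. f s - (h (U b) (W' s) + h (U' s) (W a))) has_integral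
        (integral {0..b} f - integral {0..a} f - (h (U b) (W b - W a) + h (U b - U a) (W a)))) {a..b}"
      using f_ab by (intro has_integral_diff has_integral_add)
    moreover have "integral {0..b} f - integral {0..a} f - (h (U b) (W b - W a) + h (U b - U a) (W a))
        = \<Phi> b - \<Phi> a"
      by (simp add: \<Phi>_def bilinear_lsub[OF h] bilinear_rsub[OF h])
    ultimately have int: "((\<lambda>s. f s - (h (U b) (W' s) + h (U' s) (W a))) has_integral (\<Phi> b - \<Phi> a)) {a..b}"
      by simp
    have "((\<lambda>s. norm (W' s)) has_integral (G b - G a)) {a..b}"
      using integrable_on_subinterval[OF W'abs, of a b] ab by (auto simp: G_diff has_integral_iff)
    moreover have "((\<lambda>s. G b - G a) has_integral ((b - a) *\<^sub>R (G b - G a))) {a..b}"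
      using has_integral_const_real[of "G b - G a" a b] ab by simp
    ultimately have int': "((\<lambda>s. K * M * (b - a) * norm (W' s) + K * M * (G b - G a)) has_integral
        (K * M * (b - a) * (G b - G a) + K * M * ((b - a) *\<^sub>R (G b - G a)))) {a..b}"
      by (intro has_integral_add has_integral_mult_right)
    have "norm (f s - (h (U b) (W' s) + h (U' s) (W a)))
        \<le> K * M * (b - a) * norm (W' s) + K * M * (G b - G a)" if s: "s \<in> {a..b}" for s
    proof -
      have "f s - (h (U b) (W' s) + h (U' s) (W a)) = h (U' s) (W s - W a) - h (U b - U s) (W' s)"
        by (simp add: f_def bilinear_lsub[OF h] bilinear_rsub[OF h])
      also have "norm \<dots> \<le> norm (U' s) * norm (W s - W a) * K + norm (U b - U s) * norm (W' s) * K"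
        by (intro order_trans[OF norm_triangle_ineq4] add_mono K(2))
      also have "\<dots> \<le> M * (G b - G a) * K + M * (b - a) * norm (W' s) * K"
      proof (intro add_mono mult_right_mono mult_mono)
        show "norm (U' s) \<le> M" using M s ab by auto
        show "norm (W s - W a) \<le> G b - G a"
          using W_diff[of a s] G_mono[of s b] s ab by auto
        have "norm (U b - U s) \<le> M * (b - s)" using U_diff[of s b] s ab by auto
        also have "\<dots> \<le> M * (b - a)" using M(1) s by auto
        finally show "norm (U b - U s) \<le> M * (b - a)" .
      qed (use M(1) K(1) in auto)
      finally show ?thesis by (simp add: algebra_simps)
    qed
    then have "norm (\<Phi> b - \<Phi> a) \<le> K * M * (b - a) * (G b - G a) + K * M * ((b - a) *\<^sub>R (G b - G a))"
      using Henstock_Kurzweil_Integration.integral_norm_bound_integral[OF has_integral_integrable[OF int] has_integral_integrable[OF int']]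
        integral_unique[OF int] integral_unique[OF int'] by simp
    then show ?thesis by (simp add: C_def algebra_simps)
  qed
  \<comment> \<open>The derivative at \<open>x\<close> needs increments to both sides, so
    \<open>key\<close> is freed from the order of its two points.\<close>
  have key': "norm (\<Phi> y - \<Phi> x) \<le> C * \<bar>G y - G x\<bar> * norm (y - x)" if "x \<in> {0..1}" "y \<in> {0..1}" for x y
  proof (cases "x \<le> y")
    case True
    then show ?thesis using key[of x y] G_mono[of x y] that by (simp add: algebra_simps)
  next
    case False
    then show ?thesis
      using key[of y x] G_mono[of y x] that by (simp add: algebra_simps norm_minus_commute)
  qed
  have C: "0 < C" using K M by (simp add: C_def)
  have contG: "continuous_on {0..1} G"
    unfolding G_def by (intro indefinite_integral_continuous_1 W'abs)
  have "\<exists>c. \<forall>x\<in>{0..1}. \<Phi> x = c"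
  proof (rule has_derivative_zero_constant)
    fix x :: real assume x: "x \<in> {0..1}"
    show "(\<Phi> has_derivative (\<lambda>h. 0)) (at x within {0..1})"
      unfolding has_derivative_within_alt
    proof (intro conjI allI impI)
      fix e :: real assume "0 < e"
      then have "0 < e / C" using C by simp
      then obtain d where d: "0 < d" "\<And>y. y \<in> {0..1} \<Longrightarrow> dist y x < d \<Longrightarrow> dist (G y) (G x) < e / C"
        using contG x unfolding continuous_on_iff by meson
      show "\<exists>d>0. \<forall>y\<in>{0..1}. norm (y - x) < d \<longrightarrow> norm (\<Phi> y - \<Phi> x - 0) \<le> e * norm (y - x)"
      proof (intro exI[of _ d] conjI ballI impI)
        fix y :: real assume y: "y \<in> {0..1}" "norm (y - x) < d"
        then have "C * \<bar>G y - G x\<bar> \<le> e"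
          using d(2)[of y] C by (simp add: dist_norm field_simps)
        then have "C * \<bar>G y - G x\<bar> * norm (y - x) \<le> e * norm (y - x)"
          by (rule mult_right_mono) simp
        then show "norm (\<Phi> y - \<Phi> x - 0) \<le> e * norm (y - x)"
          using key'[OF x y(1)] by simp
      qed (rule d)
    qed simp
  qed simp
  then have "\<Phi> 1 = \<Phi> 0" by force
  then have "integral {0..1} f = h (U 1) (W 1) - h (U 0) (W 0)"
    by (simp add: \<Phi>_def algebra_simps)
  then show ?thesis
    using fint by (simp add: has_integral_iff f_def[abs_def])
qed

section \<open>The index form\<close>

text \<open>Lets the closure properties be proved once, for an arbitrary subspace of end values, and
  then used for both \<open>Q\<close> and \<open>{0}\<close>.\<close>

lemma HH_P1_eq_HH_PQ: "HH_P1 g Y Y' P = HH_PQ g Y Y' P {0}"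
  by (simp add: HH_P1_def HH_PQ_def H1_P_def H1_PQ_def)

text \<open>Carries the first derivative as an explicit witness, in place of the existential in
  \<open>jacobi\<close> and the selection in \<open>jderiv\<close>, so that linear combinations and
  initial conditions can be computed.\<close>

definition jacobi_pair :: "(real \<Rightarrow> 'a \<Rightarrow>\<^sub>L 'a::euclidean_space) \<Rightarrow> (real \<Rightarrow> 'a) \<Rightarrow> (real \<Rightarrow> 'a) \<Rightarrow> bool" where
  "jacobi_pair R J J' \<longleftrightarrow> (\<forall>t\<in>{0..1}.
      (J has_vector_derivative J' t) (at t within {0..1}) \<and>
      (J' has_vector_derivative blinfun_apply (R t) (J t)) (at t within {0..1}))"

lemma jderiv_eq:
  assumes "jacobi_pair R J J'" "t \<in> {0..1}"
  shows "jderiv J t = J' t"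
  using assms by (auto simp: jderiv_def jacobi_pair_def intro!: vector_derivative_within_closed_interval)

lemma jacobi_iff: "jacobi R J \<longleftrightarrow> (\<exists>J'. jacobi_pair R J J')"
proof
  assume "jacobi R J"
  then obtain J' J'' where "\<forall>t\<in>{0..1}. (J has_vector_derivative J' t) (at t within {0..1}) \<and>
      (J' has_vector_derivative J'' t) (at t within {0..1}) \<and> J'' t = blinfun_apply (R t) (J t)"
    unfolding jacobi_def by blast
  then have "jacobi_pair R J J'" unfolding jacobi_pair_def by metis
  then show "\<exists>J'. jacobi_pair R J J'" by blast
next
  assume "\<exists>J'. jacobi_pair R J J'"
  then obtain J' where "jacobi_pair R J J'" by blast
  then show "jacobi R J"
    unfolding jacobi_def jacobi_pair_def
    by (intro exI[of _ J'] exI[of _ "\<lambda>t. blinfun_apply (R t) (J t)"]) simp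
qed

lemma jacobi_pair_zero: "jacobi_pair R (\<lambda>t. 0) (\<lambda>t. 0)"
  by (simp add: jacobi_pair_def)

lemma jacobi_pair_add:
  "jacobi_pair R J J' \<Longrightarrow> jacobi_pair R K K' \<Longrightarrow> jacobi_pair R (\<lambda>t. J t + K t) (\<lambda>t. J' t + K' t)"
  by (auto simp: jacobi_pair_def blinfun.add_right intro!: has_vector_derivative_add)

lemma jacobi_pair_scale:
  "jacobi_pair R J J' \<Longrightarrow> jacobi_pair R (\<lambda>t. r *\<^sub>R J t) (\<lambda>t. r *\<^sub>R J' t)"
  by (auto simp: jacobi_pair_def blinfun.scaleR_right intro!: bounded_linear.has_vector_derivative[OF bounded_linear_scaleR_right])

lemma jacobi_pair_H1_weak_deriv:
  assumes "jacobi_pair R J J'"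
  shows "H1_weak_deriv J J'"
proof (rule H1_weak_deriv_C1)
  show "continuous_on {0..1} J'"
    using assms by (intro continuous_on_vector_derivative) (auto simp: jacobi_pair_def)
qed (use assms in \<open>auto simp: jacobi_pair_def\<close>)

lemma JJ_Q_iff:
  "J \<in> JJ_Q g R Y Y' P SP Q \<longleftrightarrow> (\<exists>J'. jacobi_pair R J J' \<and> J 0 \<in> P \<and> J 1 \<in> Q \<and>
     (\<forall>w\<in>P. g (J' 0 + SP (J 0)) w = 0) \<and> g (J' 0) (Y 0) - g (J 0) (Y' 0) = 0)"
  by (auto simp: JJ_Q_def JJ_star_Q_def P_jacobi_def C_const_def jacobi_iff jderiv_eq)

locale index_form =
  fixes g :: "'a::euclidean_space \<Rightarrow> 'a \<Rightarrow> real"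
    and R :: "real \<Rightarrow> 'a \<Rightarrow>\<^sub>L 'a"
    and Y Y' :: "real \<Rightarrow> 'a"
    and P Q :: "'a set"
    and SP SQ :: "'a \<Rightarrow> 'a"
  assumes g: "bilinear g"
    and g_sym: "g u v = g v u"
    and R_cont: "continuous_on {0..1} R"
    and R_sym: "t \<in> {0..1} \<Longrightarrow> g (blinfun_apply (R t) u) v = g u (blinfun_apply (R t) v)"
    and Y: "jacobi_pair R Y Y'"
    and P: "subspace P"
    and SP: "linear SP"
    and SP_sym: "u \<in> P \<Longrightarrow> v \<in> P \<Longrightarrow> g (SP u) v = g u (SP v)"
    and Q: "subspace Q"
    and SQ: "linear SQ"
    and SQ_sym: "u \<in> Q \<Longrightarrow> v \<in> Q \<Longrightarrow> g (SQ u) v = g u (SQ v)"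
begin

abbreviation (input) "I \<equiv> I_PQ g R SP SQ"
abbreviation (input) "HH \<equiv> HH_PQ g Y Y' P Q"
abbreviation (input) "JJ \<equiv> JJ_Q g R Y Y' P SP Q"

lemmas g_simps = bilinear_ladd[OF g] bilinear_radd[OF g] bilinear_lsub[OF g] bilinear_rsub[OF g]
  bilinear_lmul[OF g] bilinear_rmul[OF g] bilinear_lzero[OF g] bilinear_rzero[OF g]

lemma R_continuous: "continuous_on {0..1} V \<Longrightarrow> continuous_on {0..1} (\<lambda>t. blinfun_apply (R t) (V t))"
  using R_cont by (intro continuous_intros)

lemma integrand_integrable:
  assumes "H1_weak_deriv V V'" "H1_weak_deriv W W'"
  shows "(\<lambda>t. g (V' t) (W' t) + g (blinfun_apply (R t) (V t)) (W t)) integrable_on {0..1}"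
  using assms
  by (intro integrable_add square_integrable_bilinear[OF g])
    (auto simp: H1_weak_deriv_iff
      intro!: square_integrable_continuous R_continuous H1_weak_deriv_continuous[OF assms(1)]
        H1_weak_deriv_continuous[OF assms(2)])

text \<open>Changing the derivatives on a null set leaves the integral alone. Linearity of the form
  rests on this: the sum of chosen derivatives is a weak derivative of the sum, though perhaps not
  the chosen one.\<close>

lemma I_eq:
  assumes V: "H1_weak_deriv V V'" and W: "H1_weak_deriv W W'"
  shows "I V W = integral {0..1} (\<lambda>t. g (V' t) (W' t) + g (blinfun_apply (R t) (V t)) (W t))
     + g (SQ (V 1)) (W 1) - g (SP (V 0)) (W 0)"
proof -
  have "V \<in> H1" "W \<in> H1" using V W by (auto simp: H1_def)
  then have "negligible ({t \<in> {0..1}. hderiv V t \<noteq> V' t} \<union> {t \<in> {0..1}. hderiv W t \<noteq> W' t})"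
    using H1_weak_deriv_unique[OF hderiv V] H1_weak_deriv_unique[OF hderiv W] by (simp only: negligible_Un_eq)
  then have "integral {0..1} (\<lambda>t. g (hderiv V t) (hderiv W t) + g (blinfun_apply (R t) (V t)) (W t))
      = integral {0..1} (\<lambda>t. g (V' t) (W' t) + g (blinfun_apply (R t) (V t)) (W t))"
    by (rule integral_spike) auto
  then show ?thesis by (simp add: I_PQ_def)
qed

text \<open>\<open>H1_weak_deriv\<close> sees only values on [0,1], so 0 is a weak derivative of
  such a \<open>V\<close>. This supplies the locality hypothesis of the additivity theorem.\<close>

lemma I_eq_0_if_vanishing:
  assumes "\<And>t. t \<in> {0..1} \<Longrightarrow> V t = 0"
  shows "I V V = 0"
proof -
  have "H1_weak_deriv V = H1_weak_deriv (\<lambda>t. 0)" using assms by (intro H1_weak_deriv_cong)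
  moreover have "H1_weak_deriv (\<lambda>t. 0) (\<lambda>t. 0)"
    using jacobi_pair_zero by (rule jacobi_pair_H1_weak_deriv)
  ultimately have "H1_weak_deriv V (\<lambda>t. 0)" by simp
  moreover have "integral {0..1} (\<lambda>t. g 0 0 + g (blinfun_apply (R t) (V t)) (V t)) = integral {0..1} (\<lambda>t::real. 0)"
    using assms by (intro Henstock_Kurzweil_Integration.integral_cong) (simp add: g_simps)
  ultimately show ?thesis using assms by (simp add: I_eq g_simps)
qed

text \<open>The constraint also tolerates any choice of weak derivative, as its exceptional set
  changes only within a null set.\<close>

lemma mem_HH_iff:
  assumes "H1_weak_deriv V V'"
  shows "V \<in> HH_PQ g Y Y' P T \<longleftrightarrow> V 0 \<in> P \<and> V 1 \<in> T \<and>
     negligible {t \<in> {0..1}. g (V' t) (Y t) - g (V t) (Y' t) \<noteq> 0}"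
proof -
  define N where "N U = {t \<in> {0..1}. g (U t) (Y t) - g (V t) (Y' t) \<noteq> 0}" for U
  have V: "V \<in> H1" using assms by (auto simp: H1_def)
  have "negligible {t \<in> {0..1}. hderiv V t \<noteq> V' t}"
    using H1_weak_deriv_unique[OF hderiv[OF V] assms] .
  moreover have "N V' \<subseteq> N (hderiv V) \<union> {t \<in> {0..1}. hderiv V t \<noteq> V' t}"
    "N (hderiv V) \<subseteq> N V' \<union> {t \<in> {0..1}. hderiv V t \<noteq> V' t}"
    by (auto simp: N_def)
  ultimately have "negligible (N (hderiv V)) \<longleftrightarrow> negligible (N V')"
    by (meson negligible_Un negligible_subset)
  then show ?thesis using V by (auto simp: HH_PQ_def H1_PQ_def N_def)
qed

lemma HH_H1_weak_deriv:
  assumes "V \<in> HH_PQ g Y Y' P T"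
  shows "H1_weak_deriv V (hderiv V)"
  using assms by (auto simp: HH_PQ_def H1_PQ_def intro: hderiv)

lemma HH_boundary: "V \<in> HH_PQ g Y Y' P T \<Longrightarrow> V 0 \<in> P \<and> V 1 \<in> T"
  by (simp add: HH_PQ_def H1_PQ_def)

lemma HH_zero:
  assumes "subspace T"
  shows "(\<lambda>t. 0) \<in> HH_PQ g Y Y' P T"
  using mem_HH_iff[OF jacobi_pair_H1_weak_deriv[OF jacobi_pair_zero], of T] assms P
  by (simp add: g_simps subspace_0)

lemma HH_add:
  assumes T: "subspace T" and V: "V \<in> HH_PQ g Y Y' P T" and W: "W \<in> HH_PQ g Y Y' P T"
  shows "(\<lambda>t. V t + W t) \<in> HH_PQ g Y Y' P T"
proof -
  note V' = HH_H1_weak_deriv[OF V] and W' = HH_H1_weak_deriv[OF W]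
  have "negligible ({t \<in> {0..1}. g (hderiv V t) (Y t) - g (V t) (Y' t) \<noteq> 0}
      \<union> {t \<in> {0..1}. g (hderiv W t) (Y t) - g (W t) (Y' t) \<noteq> 0})"
    using V W by (intro negligible_Un) (simp_all add: HH_PQ_def)
  then have "negligible {t \<in> {0..1}. g (hderiv V t + hderiv W t) (Y t) - g (V t + W t) (Y' t) \<noteq> 0}"
    by (rule negligible_subset) (auto simp: g_simps)
  then show ?thesis
    using HH_boundary[OF V] HH_boundary[OF W] P T
    by (simp add: mem_HH_iff[OF H1_weak_deriv_add[OF V' W']] subspace_add)
qed

lemma HH_scale:
  assumes T: "subspace T" and V: "V \<in> HH_PQ g Y Y' P T"
  shows "(\<lambda>t. r *\<^sub>R V t) \<in> HH_PQ g Y Y' P T"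
proof -
  note V' = HH_H1_weak_deriv[OF V]
  have "negligible {t \<in> {0..1}. g (hderiv V t) (Y t) - g (V t) (Y' t) \<noteq> 0}"
    using V by (simp add: HH_PQ_def)
  then have "negligible {t \<in> {0..1}. g (r *\<^sub>R hderiv V t) (Y t) - g (r *\<^sub>R V t) (Y' t) \<noteq> 0}"
    by (rule negligible_subset) (auto simp: g_simps)
  then show ?thesis
    using HH_boundary[OF V] P T
    by (simp add: mem_HH_iff[OF H1_weak_deriv_scale[OF V']] subspace_scale)
qed

lemma symmetric_form_HH: "symmetric_form HH I"
proof
  fix U V W :: "real \<Rightarrow> 'a" and r :: real
  assume U: "U \<in> HH" and W: "W \<in> HH"
  note U' = HH_H1_weak_deriv[OF U] and W' = HH_H1_weak_deriv[OF W]
  show "I (\<lambda>t. r *\<^sub>R U t) W = r * I U W"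
    unfolding I_eq[OF H1_weak_deriv_scale[OF U'] W'] I_eq[OF U' W']
    by (simp add: g_simps linear_scale[OF SP] linear_scale[OF SQ] blinfun.scaleR_right
        flip: distrib_left) (simp add: algebra_simps)
  have "integral {0..1} (\<lambda>t. g (hderiv U t) (hderiv W t) + g (blinfun_apply (R t) (U t)) (W t))
      = integral {0..1} (\<lambda>t. g (hderiv W t) (hderiv U t) + g (blinfun_apply (R t) (W t)) (U t))"
    by (intro Henstock_Kurzweil_Integration.integral_cong) (metis R_sym g_sym)
  \<comment> \<open>Symmetry of \<open>SP\<close> and \<open>SQ\<close> is given only on
    \<open>P\<close> and \<open>Q\<close>, which is where the boundary values lie.\<close>
  moreover have "g (SP (U 0)) (W 0) = g (SP (W 0)) (U 0)" "g (SQ (U 1)) (W 1) = g (SQ (W 1)) (U 1)"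
    using HH_boundary[OF U] HH_boundary[OF W] SP_sym[of "U 0" "W 0"] SQ_sym[of "U 1" "W 1"]
      g_sym[of "U 0"] g_sym[of "U 1"] by auto
  ultimately show "I U W = I W U"
    by (simp add: I_eq[OF U' W'] I_eq[OF W' U'])
  assume V: "V \<in> HH"
  note V' = HH_H1_weak_deriv[OF V]
  have "integral {0..1} (\<lambda>t. g (hderiv U t + hderiv V t) (hderiv W t) + g (blinfun_apply (R t) (U t + V t)) (W t))
    = integral {0..1} (\<lambda>t. (g (hderiv U t) (hderiv W t) + g (blinfun_apply (R t) (U t)) (W t))
        + (g (hderiv V t) (hderiv W t) + g (blinfun_apply (R t) (V t)) (W t)))"
    by (intro Henstock_Kurzweil_Integration.integral_cong) (simp add: g_simps blinfun.add_right)
  also have "\<dots> = integral {0..1} (\<lambda>t. g (hderiv U t) (hderiv W t) + g (blinfun_apply (R t) (U t)) (W t))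
      + integral {0..1} (\<lambda>t. g (hderiv V t) (hderiv W t) + g (blinfun_apply (R t) (V t)) (W t))"
    using U' V' W' by (intro Henstock_Kurzweil_Integration.integral_add integrand_integrable)
  finally show "I (\<lambda>t. U t + V t) W = I U W + I V W"
    unfolding I_eq[OF H1_weak_deriv_add[OF U' V'] W'] I_eq[OF U' W'] I_eq[OF V' W']
    by (simp add: g_simps linear_add[OF SP] linear_add[OF SQ])
qed (use Q in \<open>auto intro: HH_zero HH_add HH_scale\<close>)

text \<open>The terms in J' and Y' cancel in the derivative, leaving g(R J, Y) - g(J, R Y), which is
  0 by symmetry of R. Thus \<open>C_const\<close>, evaluated at 0, controls the constraint at every
  time.\<close>

lemma jacobi_conserved:
  assumes J: "jacobi_pair R J J'" and t: "t \<in> {0..1}"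
  shows "g (J' t) (Y t) - g (J t) (Y' t) = g (J' 0) (Y 0) - g (J 0) (Y' 0)"
proof -
  have bb: "bounded_bilinear g" using g by (simp add: bilinear_conv_bounded_bilinear)
  have "((\<lambda>t. g (J' t) (Y t) - g (J t) (Y' t)) has_vector_derivative 0) (at s within {0..1})"
    if s: "s \<in> {0..1}" for s
  proof -
    have "((\<lambda>t. g (J' t) (Y t) - g (J t) (Y' t)) has_vector_derivative
        (g (J' s) (Y' s) + g (blinfun_apply (R s) (J s)) (Y s))
        - (g (J s) (blinfun_apply (R s) (Y s)) + g (J' s) (Y' s))) (at s within {0..1})"
      using J Y s
      by (intro has_vector_derivative_diff bounded_bilinear.has_vector_derivative[OF bb])
        (auto simp: jacobi_pair_def)
    then show ?thesis using R_sym[OF s] by simp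
  qed
  then have "\<exists>c. \<forall>t\<in>{0..1}. g (J' t) (Y t) - g (J t) (Y' t) = c"
    by (intro has_derivative_zero_constant) (auto simp: has_vector_derivative_def)
  then show ?thesis using t by force
qed

lemma JJ_subset_HH: "JJ \<subseteq> HH"
proof
  fix J assume "J \<in> JJ"
  then obtain J' where J: "jacobi_pair R J J'" "J 0 \<in> P" "J 1 \<in> Q"
    "g (J' 0) (Y 0) - g (J 0) (Y' 0) = 0"
    by (auto simp: JJ_Q_iff)
  have "{t \<in> {0..1}. g (J' t) (Y t) - g (J t) (Y' t) \<noteq> 0} = {}"
    using jacobi_conserved[OF J(1)] J(4) by auto
  then have "negligible {t \<in> {0..1}. g (J' t) (Y t) - g (J t) (Y' t) \<noteq> 0}"
    by (simp only: negligible_empty)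
  then show "J \<in> HH" using J unfolding mem_HH_iff[OF jacobi_pair_H1_weak_deriv[OF J(1)]] by blast
qed

lemma symmetric_form_JJ: "symmetric_form JJ I"
proof (rule symmetric_form.symmetric_form_subset[OF symmetric_form_HH JJ_subset_HH])
  show "(\<lambda>t. 0) \<in> JJ"
    unfolding JJ_Q_iff using P Q SP
    by (intro exI[of _ "\<lambda>t. 0"]) (auto simp: jacobi_pair_zero subspace_0 linear_0 g_simps)
next
  fix J K assume "J \<in> JJ" "K \<in> JJ"
  then obtain J' K' where "jacobi_pair R J J'" "J 0 \<in> P" "J 1 \<in> Q"
      "\<forall>w\<in>P. g (J' 0 + SP (J 0)) w = 0" "g (J' 0) (Y 0) - g (J 0) (Y' 0) = 0"
    "jacobi_pair R K K'" "K 0 \<in> P" "K 1 \<in> Q"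
      "\<forall>w\<in>P. g (K' 0 + SP (K 0)) w = 0" "g (K' 0) (Y 0) - g (K 0) (Y' 0) = 0"
    unfolding JJ_Q_iff by blast
  moreover have "g (J' 0 + K' 0 + SP (J 0 + K 0)) w
      = g (J' 0 + SP (J 0)) w + g (K' 0 + SP (K 0)) w" for w
    by (simp add: linear_add[OF SP] g_simps)
  moreover have "g (J' 0 + K' 0) (Y 0) - g (J 0 + K 0) (Y' 0)
      = (g (J' 0) (Y 0) - g (J 0) (Y' 0)) + (g (K' 0) (Y 0) - g (K 0) (Y' 0))"
    by (simp add: g_simps)
  ultimately show "(\<lambda>t. J t + K t) \<in> JJ"
    unfolding JJ_Q_iff using P Q
    by (intro exI[of _ "\<lambda>t. J' t + K' t"]) (simp add: jacobi_pair_add subspace_add)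
next
  fix J r assume "J \<in> JJ"
  then obtain J' where "jacobi_pair R J J'" "J 0 \<in> P" "J 1 \<in> Q"
      "\<forall>w\<in>P. g (J' 0 + SP (J 0)) w = 0" "g (J' 0) (Y 0) - g (J 0) (Y' 0) = 0"
    unfolding JJ_Q_iff by blast
  then show "(\<lambda>t. r *\<^sub>R J t) \<in> JJ"
    unfolding JJ_Q_iff using P Q
    by (intro exI[of _ "\<lambda>t. r *\<^sub>R J' t"])
      (auto simp: jacobi_pair_scale subspace_scale linear_scale[OF SP] g_simps simp flip: distrib_left)
qed

lemma HH_P1_subset_HH: "HH_PQ g Y Y' P {0} \<subseteq> HH"
  using subspace_0[OF Q] by (auto simp: HH_PQ_def H1_PQ_def)

lemma symmetric_form_HH_P1: "symmetric_form (HH_PQ g Y Y' P {0}) I"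
  by (rule symmetric_form.symmetric_form_subset[OF symmetric_form_HH HH_P1_subset_HH])
    (auto intro!: HH_zero HH_add HH_scale)

text \<open>Integrate by parts with J' as the smooth factor: since (J')' = R J, the integrand of the
  form is the derivative of g(J', W), and only boundary terms survive.\<close>

lemma I_jacobi_eq:
  assumes J: "jacobi_pair R J J'" and W: "H1_weak_deriv W W'"
  shows "I J W = g (J' 1 + SQ (J 1)) (W 1) - g (J' 0 + SP (J 0)) (W 0)"
proof -
  have J': "H1_weak_deriv J J'" using J by (rule jacobi_pair_H1_weak_deriv)
  have "((\<lambda>t. g (J' t) (W' t) + g (blinfun_apply (R t) (J t)) (W t)) has_integral
      (g (J' 1) (W 1) - g (J' 0) (W 0))) {0..1}"
    using J W H1_weak_deriv_continuous[OF J']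
    by (intro integration_by_parts_weak[OF g]) (auto simp: jacobi_pair_def intro: R_continuous)
  then show ?thesis by (simp add: I_eq[OF J' W] integral_unique g_simps)
qed

text \<open>The boundary term at 1 dies because W(1) = 0, the one at 0 because W(0) lies in P, to
  which J'(0) + SP(J(0)) is orthogonal.\<close>

lemma I_orthogonal:
  assumes W: "W \<in> HH_PQ g Y Y' P {0}" and "J \<in> JJ"
  shows "I W J = 0"
proof -
  obtain J' where J: "jacobi_pair R J J'" "\<forall>w\<in>P. g (J' 0 + SP (J 0)) w = 0"
    using assms by (auto simp: JJ_Q_iff)
  have "W 0 \<in> P" "W 1 = 0" using W by (auto simp: HH_PQ_def H1_PQ_def)
  then have "I J W = 0"
    using J I_jacobi_eq[OF J(1) HH_H1_weak_deriv[OF W]] by (simp add: bilinear_rzero[OF g])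
  then show ?thesis
    using symmetric_form.sym[OF symmetric_form_HH] assms JJ_subset_HH HH_P1_subset_HH by fastforce
qed

lemma HH_decomposition:
  assumes J1: "Q \<subseteq> JJ_1 g R Y Y' P SP" and V: "V \<in> HH"
  shows "\<exists>W\<in>HH_PQ g Y Y' P {0}. \<exists>J\<in>JJ. V = (\<lambda>t. W t + J t)"
proof -
  have "V 1 \<in> Q" using V by (simp add: HH_PQ_def H1_PQ_def)
  \<comment> \<open>The hypothesis yields a P-Jacobi field with the right end value; its end
    condition in \<open>Q\<close> is inherited from \<open>V\<close>.\<close>
  then obtain J where J: "J \<in> JJ" "J 1 = V 1"
    using J1 by (fastforce simp: JJ_1_def JJ_Q_def JJ_star_Q_def)
  have "(\<lambda>t. V t + (- 1) *\<^sub>R J t) \<in> HH"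
    using V J JJ_subset_HH Q by (intro HH_add HH_scale) auto
  then have "(\<lambda>t. V t + (- 1) *\<^sub>R J t) \<in> HH_PQ g Y Y' P {0}"
    using J(2) by (simp add: HH_PQ_def H1_PQ_def)
  then show ?thesis using J(1) by (intro bexI[of _ "\<lambda>t. V t + (- 1) *\<^sub>R J t"] bexI[of _ J]) auto
qed

theorem n_minus_HH:
  assumes "Q \<subseteq> JJ_1 g R Y Y' P SP"
  shows "n_minus_fun {0..1} I HH = n_minus_fun {0..1} I (HH_P1 g Y Y' P) + n_minus_fun {0..1} I JJ"
  unfolding HH_P1_eq_HH_PQ
  using symmetric_form_HH_P1 HH_P1_subset_HH symmetric_form_JJ JJ_subset_HH
  by (rule symmetric_form.n_minus_fun_orthogonal_sum[OF symmetric_form_HH])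
    (use HH_decomposition[OF assms] I_orthogonal I_eq_0_if_vanishing in blast)+

end

theorem mainTheorem2:
  fixes g :: "'a::euclidean_space \<Rightarrow> 'a \<Rightarrow> real"
    and R :: "real \<Rightarrow> 'a \<Rightarrow>\<^sub>L 'a"
    and Y Y' Y'' :: "real \<Rightarrow> 'a"
    and P Q :: "'a set"
    and SP SQ :: "'a \<Rightarrow> 'a"
  assumes g_bilinear: "bilinear g"
    and g_sym: "\<And>u v. g u v = g v u"
    and g_nondeg: "\<And>v. (\<forall>w. g v w = 0) \<Longrightarrow> v = 0"
    and g_index: "n_minus g UNIV = 1"
    and R_cont: "continuous_on {0..1} R"
    and R_sym: "\<And>t u v. t \<in> {0..1} \<Longrightarrow> g (blinfun_apply (R t) u) v = g u (blinfun_apply (R t) v)"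
    and Y_deriv: "\<And>t. t \<in> {0..1} \<Longrightarrow> (Y has_vector_derivative Y' t) (at t within {0..1})"
    and Y'_deriv: "\<And>t. t \<in> {0..1} \<Longrightarrow> (Y' has_vector_derivative Y'' t) (at t within {0..1})"
    and Y''_cont: "continuous_on {0..1} Y''"
    and Y_jacobi: "\<And>t. t \<in> {0..1} \<Longrightarrow> Y'' t = blinfun_apply (R t) (Y t)"
    and Y_timelike: "\<And>t. t \<in> {0..1} \<Longrightarrow> g (Y t) (Y t) < 0"
    and P_sub: "subspace P"
    and P_nondeg: "\<And>v. v \<in> P \<Longrightarrow> (\<forall>w\<in>P. g v w = 0) \<Longrightarrow> v = 0"
    and SP_lin: "linear SP"
    and SP_maps: "SP ` P \<subseteq> P"
    and SP_sym: "\<And>u v. u \<in> P \<Longrightarrow> v \<in> P \<Longrightarrow> g (SP u) v = g u (SP v)"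
    and Q_sub: "subspace Q"
    and SQ_lin: "linear SQ"
    and SQ_maps: "SQ ` Q \<subseteq> Q"
    and SQ_sym: "\<And>u v. u \<in> Q \<Longrightarrow> v \<in> Q \<Longrightarrow> g (SQ u) v = g u (SQ v)"
    and J1_Q: "Q \<subseteq> JJ_1 g R Y Y' P SP"
  shows "n_minus_fun {0..1} (I_PQ g R SP SQ) (HH_PQ g Y Y' P Q)
       = n_minus_fun {0..1} (I_PQ g R SP SQ) (HH_P1 g Y Y' P)
         + n_minus_fun {0..1} (I_PQ g R SP SQ) (JJ_Q g R Y Y' P SP Q)"
proof -
  have Y: "jacobi_pair R Y Y'"
    using Y_deriv Y'_deriv Y_jacobi unfolding jacobi_pair_def by metis
  interpret index_form g R Y Y' P Q SP SQ
    by (rule index_form.intro) (fact | rule R_sym SP_sym SQ_sym, assumption+)+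
  show ?thesis using J1_Q by (rule n_minus_HH)
qed

end
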